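(* If $f_{ik}(s)\in H$ for all $i,k\in\{1,2\}$ and $$\min\Big\{ \inf_{\omega\in\mathbb{R}} \Re \frac{g_{i_1 j_1}(j\omega)}{f_{i_2 j_2}(j\omega)} \;:\; (i_1\, j_1\, i_2\, j_2) \in I_3 \Big\} =: \gamma_0 < 0,$$ then $$\min\Big\{ \inf_{\omega\in\mathbb{R}} \Re \frac{g(j\omega)}{f(j\omega)} \;:\; g(s)\in K^m(s),\ f(s)\in K^n(s) \Big\} = \gamma_0 .$$
   Context: $j$ (not as a subscript) is the imaginary unit. $H$ is the set of Hurwitz stable polynomials (all zeros in the open left half plane). Let $m\le n$, and let real numbers $a_i^-\le a_i^+$ ($0\le i\le m$), $b_i^-\le b_i^+$ ($0\le i\le n$) be given. The $m$-th and $n$-th order real interval polynomials are $$K^m(s)=\Big\{\sum_{i=0}^m a_i s^i : a_i\in[a_i^-,a_i^+]\Big\},\qquad K^n(s)=\Big\{\sum_{i=0}^n b_i s^i : b_i\in[b_i^-,b_i^+]\Big\},$$ where all members of $K^n(s)$ have order exactly $n$, i.e. $0\notin[b_n^-,b_n^+]$. Define (sums truncated at degree $m$) $\alpha_g^{(1)}(s^2)=a_0^-+a_2^+s^2+a_4^-s^4+a_6^+s^6+\cdots$, $\alpha_g^{(2)}(s^2)=a_0^++a_2^-s^2+a_4^+s^4+a_6^-s^6+\cdots$, $\beta_g^{(1)}(s^2)=a_1^-+a_3^+s^2+a_5^-s^4+a_7^+s^6+\cdots$, $\beta_g^{(2)}(s^2)=a_1^++a_3^-s^2+a_5^+s^4+a_7^-s^6+\cdots$,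 and $g_{ik}(s)=\alpha_g^{(i)}(s^2)+s\,\beta_g^{(k)}(s^2)\in K^m(s)$ for $i,k\in\{1,2\}$. The polynomials $f_{ik}(s)\in K^n(s)$ are defined in the same way from the bounds $b_i^\pm$. The index set is $I_3=\{(1111),(1212),(2222),(2121),(1112),(1222),(2221),(2111),(1211),(2212),(2122),(1121)\}$, where $(i_1\,j_1\,i_2\,j_2)$ is a 4-tuple with entries in $\{1,2\}$. *)

theory Defs
  imports Complex_Main "HOL-Library.Extended_Real" "HOL-Computational_Algebra.Polynomial"
begin

definition cpoly :: "real poly \<Rightarrow> complex \<Rightarrow> complex" where
  "cpoly p z = poly (map_poly complex_of_real p) z"

text \<open>The zero polynomial is not Hurwitz, since every point is a zero of it; nonzero constants are.\<close>

definition hurwitz :: "real poly \<Rightarrow> bool" where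
  "hurwitz p \<longleftrightarrow> (\<forall>z. cpoly p z = 0 \<longrightarrow> Re z < 0)"

text \<open>Only the bounds with index at most \<open>n\<close> matter. The leading coefficient may vanish.\<close>

definition interval_polys :: "nat \<Rightarrow> (nat \<Rightarrow> real) \<Rightarrow> (nat \<Rightarrow> real) \<Rightarrow> real poly set" where
  "interval_polys n lo hi =
     {(\<Sum>i\<le>n. monom (c i) i) |c. \<forall>i\<le>n. c i \<in> {lo i..hi i}}"

text \<open>The alternating bound: \<open>lo, hi, lo, hi, \<dots>\<close> for \<open>i = 1\<close> and \<open>hi, lo, hi, lo, \<dots>\<close> for
  \<open>i = 2\<close>, where \<open>r\<close> counts the powers of \<open>s\<^sup>2\<close> and \<open>k\<close> is the index of the coefficient.\<close>

definition alt_bound ::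
  "(nat \<Rightarrow> real) \<Rightarrow> (nat \<Rightarrow> real) \<Rightarrow> nat \<Rightarrow> nat \<Rightarrow> nat \<Rightarrow> real" where
  "alt_bound lo hi i r k = (if even r \<longleftrightarrow> i = 1 then lo k else hi k)"

text \<open>\<open>vertex_even\<close> and \<open>vertex_odd\<close> are polynomials in the variable \<open>s\<^sup>2\<close>.\<close>

definition vertex_even :: "nat \<Rightarrow> (nat \<Rightarrow> real) \<Rightarrow> (nat \<Rightarrow> real) \<Rightarrow> nat \<Rightarrow> real poly" where
  "vertex_even n lo hi i = (\<Sum>r | 2 * r \<le> n. monom (alt_bound lo hi i r (2 * r)) r)"

definition vertex_odd :: "nat \<Rightarrow> (nat \<Rightarrow> real) \<Rightarrow> (nat \<Rightarrow> real) \<Rightarrow> nat \<Rightarrow> real poly" where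
  "vertex_odd n lo hi k = (\<Sum>r | 2 * r + 1 \<le> n. monom (alt_bound lo hi k r (2 * r + 1)) r)"

definition vertex_poly ::
  "nat \<Rightarrow> (nat \<Rightarrow> real) \<Rightarrow> (nat \<Rightarrow> real) \<Rightarrow> nat \<Rightarrow> nat \<Rightarrow> real poly" where
  "vertex_poly n lo hi i k =
     pcompose (vertex_even n lo hi i) (monom 1 2)
     + monom 1 1 * pcompose (vertex_odd n lo hi k) (monom 1 2)"

text \<open>The infimum is taken in the extended reals, so that it is meaningful without first
  knowing that the real part is bounded below.\<close>

definition inf_re_ratio :: "real poly \<Rightarrow> real poly \<Rightarrow> ereal" where
  "inf_re_ratio g f =
     (INF \<omega>::real. ereal (Re (cpoly g (\<i> * of_real \<omega>) / cpoly f (\<i> * of_real \<omega>))))"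

definition I3 :: "(nat \<times> nat \<times> nat \<times> nat) set" where
  "I3 = {(1,1,1,1), (1,2,1,2), (2,2,2,2), (2,1,2,1),
         (1,1,1,2), (1,2,2,2), (2,2,2,1), (2,1,1,1),
         (1,2,1,1), (2,2,1,2), (2,1,2,2), (1,1,2,1)}"

definition is_minimum :: "ereal set \<Rightarrow> ereal \<Rightarrow> bool" where
  "is_minimum S x \<longleftrightarrow> x \<in> S \<and> (\<forall>y\<in>S. x \<le> y)"

end

theory Submission
  imports Defs "HOL-Complex_Analysis.Conformal_Mappings"
    "HOL-Computational_Algebra.Fundamental_Theorem_Algebra"
begin

text \<open>
  At a frequency \<open>\<omega> \<ge> 0\<close> the values of an interval polynomial fill a rectangle with sides parallel
  to the axes, and the corners are the values of the four vertex polynomials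
  (\<open>interval_polys_axis\<close>). So the task is to bound \<open>Re (g / f)\<close> from below by a number \<open>\<gamma> \<le> 0\<close>,
  where \<open>g\<close> and \<open>f\<close> range over two rectangles and the bound is known for twelve pairs of corners
  at all frequencies. Knowing it at a single frequency would not suffice, because the ratio can
  have a smaller real part inside an edge for \<open>f\<close> than at its ends.

  Edges are handled by a dynamical argument. Along an edge only the even part or only the odd part
  of \<open>f\<close> varies, so on the imaginary axis the edge has the same direction at all frequencies. If
  \<open>g / f\<close> had a value \<open>c\<close> with \<open>Re c < \<gamma>\<close> on the edge from \<open>f0\<close> to \<open>f1\<close>, then the segment from
  \<open>g - c f0\<close> to \<open>g - c f1\<close> would contain \<open>0\<close>. By the minimum principle on the right half plane the
  two end points are stable complex polynomials (\<open>stable_diff_smult\<close>), hence both turn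
  counterclockwise as the frequency increases. Two points on opposite sides of \<open>0\<close> that both turn
  counterclockwise also turn the segment between them, which contradicts the constant
  direction (\<open>edge_nonvanishing\<close>, \<open>Re_ratio_ge_edge\<close>). The same lemma shows that the
  rectangle for \<open>f\<close> never contains \<open>0\<close> (\<open>rectangle_excludes_zero\<close>).

  From the edges to the rectangles the argument is at a fixed frequency. For given \<open>f\<close> the best \<open>g\<close>
  is a corner determined by the quadrant of \<open>f\<close>, and a negative real part becomes smaller still
  when \<open>f\<close> is scaled towards the origin, until it meets an edge. The pairs of corners that occur in
  this way are exactly those in \<open>I3\<close> (\<open>rectangle_ratio_bound\<close>).
\<close>

section \<open>Stable polynomials and their phase\<close>

definition stable :: "complex poly \<Rightarrow> bool" where
  "stable p \<longleftrightarrow> (\<forall>z. poly p z = 0 \<longrightarrow> Re z < 0)"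

lemma stable_nonzero: "stable p \<Longrightarrow> 0 \<le> Re z \<Longrightarrow> poly p z \<noteq> 0"
  by (auto simp: stable_def not_less)

lemma Re_inverse_pos:
  assumes "0 < Re w"
  shows "0 < Re (1 / w)"
proof -
  have "w \<noteq> 0" using assms by auto
  then have "0 < (Re w)\<^sup>2 + (Im w)\<^sup>2" by (simp add: complex_neq_0)
  then show ?thesis using assms by (simp add: Re_divide)
qed

text \<open>A factor \<open>z - r\<close> contributes \<open>1 / (z - r)\<close> to the logarithmic derivative, and this
  lies in the right half plane if \<open>Re r < 0 \<le> Re z\<close>. On the imaginary axis the real part is the
  derivative of the argument, so this is the statement that the phase of a stable polynomial
  increases with the frequency.\<close>

lemma Re_logderiv_stable:
  assumes "stable p" "0 \<le> Re z"
  shows "0 \<le> Re (poly (pderiv p) z / poly p z) \<and>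
    (0 < degree p \<longrightarrow> 0 < Re (poly (pderiv p) z / poly p z))"
  using assms(1)
proof (induction "degree p" arbitrary: p)
  case 0
  then obtain a where "p = [:a:]" by (metis degree_eq_zeroE)
  then show ?case by (simp add: pderiv_pCons)
next
  case (Suc k)
  then have "\<not> constant (poly p)" by (simp add: constant_degree)
  then obtain r where r: "poly p r = 0" using fundamental_theorem_of_algebra by blast
  then obtain q where q: "p = [:- r, 1:] * q" by (metis dvdE poly_eq_0_iff_dvd)
  have "p \<noteq> 0" using Suc by auto
  then have "q \<noteq> 0" using q by auto
  then have "degree p = Suc (degree q)" unfolding q by (subst degree_mult_eq) auto
  then have dq: "k = degree q" using Suc by simp
  have sq: "stable q" using Suc.prems by (auto simp: stable_def q)
  have "Re r < 0" using r Suc.prems by (auto simp: stable_def)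
  then have pos: "0 < Re (z - r)" using assms(2) by simp
  then have nz: "z - r \<noteq> 0" by auto
  have qz: "poly q z \<noteq> 0" using sq assms(2) by (rule stable_nonzero)
  have "poly p z = (z - r) * poly q z"
    unfolding q by (simp add: algebra_simps)
  moreover have "poly (pderiv p) z = (z - r) * poly (pderiv q) z + poly q z"
    unfolding q pderiv_mult by (simp add: pderiv_pCons algebra_simps)
  ultimately have "poly (pderiv p) z / poly p z = 1 / (z - r) + poly (pderiv q) z / poly q z"
    using nz qz by (simp add: add_divide_distrib)
  moreover have "0 \<le> Re (poly (pderiv q) z / poly q z)" using Suc.hyps(1)[OF dq sq] by blast
  moreover have "0 < Re (1 / (z - r))" using pos by (rule Re_inverse_pos)
  ultimately show ?case by simp
qed

lemma Re_pderiv_zero_if_Im_zero_on_axis: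
  fixes p :: "complex poly"
  assumes "d \<noteq> 0" and "\<And>\<omega>::real. Im (poly p (\<i> * of_real \<omega>) / d) = 0"
  shows "Re (poly (pderiv p) (\<i> * of_real \<omega>) / d) = 0"
proof -
  have "((\<lambda>z. poly p (\<i> * z) / d) has_field_derivative (poly (pderiv p) (\<i> * of_real \<omega>) * \<i>) / d)
      (at (of_real \<omega>))"
    using assms(1) by (auto intro!: derivative_eq_intros DERIV_chain2[where f = "poly p"] poly_DERIV)
  then have "((\<lambda>t. poly p (\<i> * of_real t) / d) has_vector_derivative
      (poly (pderiv p) (\<i> * of_real \<omega>) * \<i>) / d) (at \<omega>)"
    by (rule has_vector_derivative_real_field)
  then have "((\<lambda>t. Im (poly p (\<i> * of_real t) / d)) has_real_derivative
      Im ((poly (pderiv p) (\<i> * of_real \<omega>) * \<i>) / d)) (at \<omega>)"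
    unfolding has_real_derivative_iff_has_vector_derivative
    by (rule bounded_linear.has_vector_derivative[OF bounded_linear_Im])
  moreover have "((\<lambda>t::real. Im (poly p (\<i> * of_real t) / d)) has_real_derivative 0) (at \<omega>)"
    using assms by simp
  ultimately have "Im ((poly (pderiv p) (\<i> * of_real \<omega>) * \<i>) / d) = 0"
    by (rule DERIV_unique)
  moreover have "(poly (pderiv p) (\<i> * of_real \<omega>) * \<i>) / d = \<i> * (poly (pderiv p) (\<i> * of_real \<omega>) / d)"
    by simp
  ultimately show ?thesis by (metis Im_i_times)
qed

text \<open>The reason why stability of end points carries over to a segment. Suppose that the segment
  from \<open>P0\<close> to \<open>P1\<close> contains \<open>0\<close> at some frequency. Then both end points lie on the line through
  \<open>0\<close> in direction \<open>d\<close>, on opposite sides of \<open>0\<close>. Both turn counterclockwise, so their velocities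
  have components of opposite sign across the line. But the segment keeps its direction at all
  frequencies, so these components agree.\<close>

lemma edge_nonvanishing:
  assumes st: "stable P0" "stable P1" and deg: "0 < degree P0"
    and dir: "\<And>\<omega>::real. Im ((poly P1 (\<i> * of_real \<omega>) - poly P0 (\<i> * of_real \<omega>)) / d) = 0"
    and d: "d \<noteq> 0" and lam: "0 \<le> l" "l \<le> 1"
  shows "(1 - of_real l) * poly P0 (\<i> * of_real \<omega>) + of_real l * poly P1 (\<i> * of_real \<omega>) \<noteq> 0"
proof
  let ?z = "\<i> * complex_of_real \<omega>"
  assume z: "(1 - of_real l) * poly P0 ?z + of_real l * poly P1 ?z = 0"
  have nz: "poly P0 ?z \<noteq> 0" "poly P1 ?z \<noteq> 0" using st stable_nonzero[of _ ?z] by simp_all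
  have l0: "l \<noteq> 0" using z nz by auto
  have l1: "l \<noteq> 1" using z nz by auto
  \<comment> \<open>On the axis \<open>P1 - P0\<close> is a real multiple \<open>r\<close> of \<open>d\<close>.\<close>
  define r where "r = Re ((poly P1 ?z - poly P0 ?z) / d)"
  have "(poly P1 ?z - poly P0 ?z) / d = of_real r"
    using dir[of \<omega>] by (simp add: r_def complex_eq_iff)
  then have r: "poly P1 ?z - poly P0 ?z = of_real r * d" using d by (simp add: field_simps)
  have P0: "poly P0 ?z = of_real (- l * r) * d"
  proof -
    have "poly P0 ?z = ((1 - of_real l) * poly P0 ?z + of_real l * poly P1 ?z)
        - of_real l * (poly P1 ?z - poly P0 ?z)"
      by (simp add: algebra_simps)
    then show ?thesis unfolding z r by simp
  qed
  have P1: "poly P1 ?z = of_real ((1 - l) * r) * d"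
  proof -
    have "poly P1 ?z = of_real r * d + poly P0 ?z" using r by (metis diff_add_cancel)
    then show ?thesis unfolding P0 by (simp add: algebra_simps)
  qed
  have r0: "r \<noteq> 0" using P0 nz by auto
  \<comment> \<open>The components of the two velocities across the line \<open>\<real> d\<close> agree.\<close>
  have "Re (poly (pderiv (P1 - P0)) ?z / d) = 0"
    by (rule Re_pderiv_zero_if_Im_zero_on_axis[OF d]) (simp only: poly_diff dir)
  then have eq: "Re (poly (pderiv P1) ?z / d) = Re (poly (pderiv P0) ?z / d)"
    by (simp add: pderiv_diff diff_divide_distrib)
  have scale: "Re (of_real a * w) = a * Re w" for a w by simp
  have "0 < Re (poly (pderiv P0) ?z / poly P0 ?z)"
    using Re_logderiv_stable[OF st(1), of ?z] deg by simp
  also have "poly (pderiv P0) ?z / poly P0 ?z = of_real (1 / (- l * r)) * (poly (pderiv P0) ?z / d)"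
    unfolding P0 by simp
  also have "Re \<dots> = Re (poly (pderiv P0) ?z / d) / (- l * r)"
    unfolding scale by simp
  finally have 1: "0 < Re (poly (pderiv P0) ?z / d) / (- l * r)" .
  have "0 \<le> Re (poly (pderiv P1) ?z / poly P1 ?z)"
    using Re_logderiv_stable[OF st(2), of ?z] by simp
  also have "poly (pderiv P1) ?z / poly P1 ?z = of_real (1 / ((1 - l) * r)) * (poly (pderiv P1) ?z / d)"
    unfolding P1 by simp
  also have "Re \<dots> = Re (poly (pderiv P0) ?z / d) / ((1 - l) * r)"
    unfolding scale eq by simp
  finally have 2: "0 \<le> Re (poly (pderiv P0) ?z / d) / ((1 - l) * r)" .
  have "0 < l" "0 < 1 - l" using lam l0 l1 by auto
  then show False using 1 2 r0
    by (auto simp: zero_less_divide_iff zero_le_divide_iff divide_less_0_iff mult_less_0_iff zero_less_mult_iff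
        zero_le_mult_iff mult_le_0_iff)
qed

section \<open>Lower bounds for the real part of a rational function\<close>

text \<open>The value of a proper rational function at infinity; \<open>coeff g (degree f)\<close> is \<open>0\<close> if the
  function is strictly proper.\<close>

lemma poly_ratio_tendsto:
  fixes f g :: "complex poly"
  assumes "degree g \<le> degree f" "f \<noteq> 0"
  shows "((\<lambda>z. poly g z / poly f z) \<longlongrightarrow> coeff g (degree f) / lead_coeff f) at_infinity"
proof -
  let ?n = "degree f"
  have f: "((\<lambda>z. poly f z / z ^ ?n) \<longlongrightarrow> lead_coeff f) at_infinity"
    by (rule poly_divide_tendsto_aux)
  have g: "((\<lambda>z. poly g z / z ^ ?n) \<longlongrightarrow> coeff g ?n) at_infinity"
  proof (cases "degree g = ?n")
    case True
    then show ?thesis using poly_divide_tendsto_aux[of g] by simp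
  next
    case False
    then have lt: "degree g < ?n" using assms by simp
    then have c: "coeff g ?n = 0" by (rule coeff_eq_0)
    have "((\<lambda>z::complex. 1 / z ^ (?n - degree g)) \<longlongrightarrow> 0) at_infinity"
      using lt by (intro tendsto_divide_0[OF tendsto_const] filterlim_power_at_infinity filterlim_ident) auto
    then have "((\<lambda>z. (poly g z / z ^ degree g) * (1 / z ^ (?n - degree g))) \<longlongrightarrow> lead_coeff g * 0) at_infinity"
      by (intro tendsto_mult poly_divide_tendsto_aux)
    moreover have "(poly g z / z ^ degree g) * (1 / z ^ (?n - degree g)) = poly g z / z ^ ?n" for z
      using lt by (simp add: power_add[symmetric])
    ultimately show ?thesis unfolding c by (simp only: mult_zero_right)
  qed
  have "((\<lambda>z. (poly g z / z ^ ?n) / (poly f z / z ^ ?n)) \<longlongrightarrow> coeff g ?n / lead_coeff f) at_infinity"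
    using f g assms(2) by (intro tendsto_divide) auto
  moreover have "\<forall>\<^sub>F z in at_infinity. (poly g z / z ^ ?n) / (poly f z / z ^ ?n) = poly g z / poly f z"
    unfolding eventually_at_infinity by (rule exI[of _ 1]) auto
  ultimately show ?thesis by (simp add: filterlim_cong[OF refl refl] Lim_transform_eventually)
qed

lemma Re_lead_ratio_ge:
  fixes f g :: "complex poly"
  assumes "degree g \<le> degree f" "f \<noteq> 0"
    and axis: "\<And>\<omega>::real. \<gamma> \<le> Re (poly g (\<i> * of_real \<omega>) / poly f (\<i> * of_real \<omega>))"
  shows "\<gamma> \<le> Re (coeff g (degree f) / lead_coeff f)"
proof -
  have "filterlim (\<lambda>x::real. \<i> * complex_of_real x) at_infinity at_top"
    unfolding filterlim_at_infinity_conv_norm_at_top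
    by (simp add: norm_mult filterlim_abs_real)
  then have "((\<lambda>x::real. poly g (\<i> * of_real x) / poly f (\<i> * of_real x))
      \<longlongrightarrow> coeff g (degree f) / lead_coeff f) at_top"
    by (rule filterlim_compose[OF poly_ratio_tendsto[OF assms(1,2)]])
  then have "((\<lambda>x::real. Re (poly g (\<i> * of_real x) / poly f (\<i> * of_real x)))
      \<longlongrightarrow> Re (coeff g (degree f) / lead_coeff f)) at_top"
    by (rule tendsto_Re)
  then show ?thesis by (rule tendsto_lowerbound) (use axis in auto)
qed

text \<open>The minimum principle for the harmonic function \<open>Re (g / f)\<close> on the right half plane,
  obtained from the maximum modulus principle for \<open>exp (- g / f)\<close> on large half discs. On the arc
  the bound holds up to \<open>e\<close>, because \<open>g / f\<close> has a limit at infinity which is also its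
  limit along the axis.\<close>

lemma Re_ratio_ge_half_plane:
  assumes st: "stable f" and deg: "degree g \<le> degree f"
    and axis: "\<And>\<omega>::real. \<gamma> \<le> Re (poly g (\<i> * of_real \<omega>) / poly f (\<i> * of_real \<omega>))"
    and z: "0 \<le> Re z"
  shows "\<gamma> \<le> Re (poly g z / poly f z)"
proof (rule field_le_epsilon)
  fix e :: real assume e: "0 < e"
  have f0: "f \<noteq> 0" using stable_nonzero[OF st, of 0] by auto
  have "((\<lambda>z. Re (poly g z / poly f z)) \<longlongrightarrow> Re (coeff g (degree f) / lead_coeff f)) at_infinity"
    by (intro tendsto_Re poly_ratio_tendsto deg f0)
  moreover have "\<gamma> - e < Re (coeff g (degree f) / lead_coeff f)"
    using Re_lead_ratio_ge[OF deg f0 axis] e by simp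
  ultimately have "\<forall>\<^sub>F z in at_infinity. \<gamma> - e < Re (poly g z / poly f z)"
    by (rule order_tendstoD)
  then obtain R0 where R0: "\<And>z. R0 \<le> norm z \<Longrightarrow> \<gamma> - e < Re (poly g z / poly f z)"
    unfolding eventually_at_infinity by blast
  define R where "R = max R0 (norm z)"
  define S where "S = {s. 0 \<le> Re s} \<inter> cball 0 R"
  have "closed S" unfolding S_def by (intro closed_Int closed_halfspace_Re_ge closed_cball)
  have hol: "(\<lambda>s. exp (- (poly g s / poly f s))) holomorphic_on S"
    by (intro holomorphic_intros) (auto simp: S_def stable_nonzero[OF st])
  have "norm (exp (- (poly g z / poly f z))) \<le> exp (- (\<gamma> - e))"
  proof (rule maximum_modulus_frontier[where S = S and f = "\<lambda>s. exp (- (poly g s / poly f s))"])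
    show "(\<lambda>s. exp (- (poly g s / poly f s))) holomorphic_on interior S"
      using hol interior_subset by (rule holomorphic_on_subset)
    show "continuous_on (closure S) (\<lambda>s. exp (- (poly g s / poly f s)))"
      using hol \<open>closed S\<close> by (simp add: holomorphic_on_imp_continuous_on)
    show "bounded S" unfolding S_def by (simp add: bounded_Int)
    show "z \<in> S" using z by (auto simp: S_def R_def)
    fix s assume s: "s \<in> frontier S"
    have sS: "s \<in> S" using s \<open>closed S\<close> by (simp add: frontier_def)
    have "open ({s. 0 < Re s} \<inter> ball 0 R)"
      by (intro open_Int open_halfspace_Re_gt open_ball)
    then have "{s. 0 < Re s} \<inter> ball 0 R \<subseteq> interior S"
      by (intro interior_maximal) (auto simp: S_def)
    then have "Re s = 0 \<or> norm s = R" using s sS by (force simp: frontier_def S_def)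
    then have "\<gamma> - e \<le> Re (poly g s / poly f s)"
    proof
      assume "Re s = 0"
      then have "s = \<i> * of_real (Im s)" by (simp add: complex_eq_iff)
      then show ?thesis using axis[of "Im s"] e by simp
    next
      assume "norm s = R"
      then show ?thesis using R0[of s] by (auto simp: R_def)
    qed
    then show "norm (exp (- (poly g s / poly f s))) \<le> exp (- (\<gamma> - e))"
      by simp
  qed
  then show "\<gamma> \<le> Re (poly g z / poly f z) + e" by simp
qed

text \<open>By the minimum principle \<open>g / f\<close> does not take the value \<open>c\<close> on the closed right half
  plane. It does not take it at infinity either, which keeps the degree from dropping.\<close>

lemma stable_diff_smult:
  assumes st: "stable f" and deg: "degree g \<le> degree f"
    and axis: "\<And>\<omega>::real. \<gamma> \<le> Re (poly g (\<i> * of_real \<omega>) / poly f (\<i> * of_real \<omega>))"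
    and c: "Re c < \<gamma>"
  shows "stable (g - smult c f)" and "degree (g - smult c f) = degree f"
proof -
  have f0: "f \<noteq> 0" using stable_nonzero[OF st, of 0] by auto
  show "stable (g - smult c f)"
    unfolding stable_def
  proof (intro allI impI, rule ccontr)
    fix z assume z: "poly (g - smult c f) z = 0" "\<not> Re z < 0"
    then have "poly f z \<noteq> 0" using stable_nonzero[OF st, of z] by simp
    then have "poly g z / poly f z = c" using z by (simp add: field_simps)
    then show False using Re_ratio_ge_half_plane[OF st deg axis, of z] z c by simp
  qed
  have "coeff g (degree f) \<noteq> c * lead_coeff f"
  proof
    assume "coeff g (degree f) = c * lead_coeff f"
    then have "coeff g (degree f) / lead_coeff f = c" using f0 by simp
    then show False using Re_lead_ratio_ge[OF deg f0 axis] c by simp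
  qed
  then have "degree f \<le> degree (g - smult c f)" by (intro le_degree) simp
  moreover have "degree (g - smult c f) \<le> degree f"
    using deg by (intro degree_diff_le) (auto intro: order_trans[OF degree_smult_le])
  ultimately show "degree (g - smult c f) = degree f" by simp
qed

text \<open>If \<open>g / f = c\<close> with \<open>Re c < \<gamma>\<close> at one frequency for some \<open>f\<close> between \<open>f0\<close> and \<open>f1\<close>,
  then the segment from \<open>g - c f0\<close> to \<open>g - c f1\<close> contains \<open>0\<close> there. Its end points are stable
  and its direction on the axis is that of \<open>c d\<close>, so this is impossible. The sign of \<open>\<gamma>\<close> enters
  because the direction degenerates for \<open>c = 0\<close>.\<close>

lemma Re_ratio_ge_edge:
  assumes st: "stable f0" "stable f1" and n: "0 < degree f0"
    and deg: "degree g \<le> degree f0" "degree g \<le> degree f1"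
    and axis0: "\<And>\<omega>::real. \<gamma> \<le> Re (poly g (\<i> * of_real \<omega>) / poly f0 (\<i> * of_real \<omega>))"
    and axis1: "\<And>\<omega>::real. \<gamma> \<le> Re (poly g (\<i> * of_real \<omega>) / poly f1 (\<i> * of_real \<omega>))"
    and neg: "\<gamma> \<le> 0"
    and dir: "\<And>\<omega>::real. Im ((poly f1 (\<i> * of_real \<omega>) - poly f0 (\<i> * of_real \<omega>)) / d) = 0"
    and d: "d \<noteq> 0" and lam: "0 \<le> l" "l \<le> 1"
  shows "\<gamma> \<le> Re (poly g (\<i> * of_real \<omega>) /
      ((1 - of_real l) * poly f0 (\<i> * of_real \<omega>) + of_real l * poly f1 (\<i> * of_real \<omega>)))"
proof (rule ccontr)
  let ?z = "\<i> * complex_of_real \<omega>"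
  let ?f = "(1 - of_real l) * poly f0 ?z + of_real l * poly f1 ?z"
  define c where "c = poly g ?z / ?f"
  assume "\<not> ?thesis"
  then have c: "Re c < \<gamma>" by (simp add: c_def)
  then have c0: "c \<noteq> 0" using neg by auto
  then have "?f \<noteq> 0" by (auto simp: c_def)
  then have zero: "poly g ?z - c * ?f = 0" by (simp add: c_def)
  note P0 = stable_diff_smult[OF st(1) deg(1) axis0 c]
  note P1 = stable_diff_smult[OF st(2) deg(2) axis1 c]
  have "Im ((poly (g - smult c f1) (\<i> * of_real t) - poly (g - smult c f0) (\<i> * of_real t)) / (- c * d)) = 0" for t
  proof -
    have "(poly (g - smult c f1) (\<i> * of_real t) - poly (g - smult c f0) (\<i> * of_real t)) / (- c * d)
        = (- c) * (poly f1 (\<i> * of_real t) - poly f0 (\<i> * of_real t)) / (- c * d)"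
      by (simp add: algebra_simps)
    also have "\<dots> = (poly f1 (\<i> * of_real t) - poly f0 (\<i> * of_real t)) / d"
      using c0 by (subst mult_divide_mult_cancel_left) auto
    finally show ?thesis using dir[of t] by simp
  qed
  then have "(1 - of_real l) * poly (g - smult c f0) ?z + of_real l * poly (g - smult c f1) ?z \<noteq> 0"
    using P0 P1 n c0 d lam by (intro edge_nonvanishing[where d = "- c * d"]) auto
  moreover have "(1 - of_real l) * poly (g - smult c f0) ?z + of_real l * poly (g - smult c f1) ?z
      = poly g ?z - c * ?f"
    by (simp add: algebra_simps)
  ultimately show False using zero by simp
qed

section \<open>Even and odd parts of a polynomial on the imaginary axis\<close>

lemma cpoly_pCons: "cpoly (pCons a p) z = of_real a + z * cpoly p z"
  by (simp add: cpoly_def map_poly_pCons)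

lemma cpoly_0 [simp]: "cpoly 0 z = 0"
  by (simp add: cpoly_def)

lemma cpoly_add: "cpoly (p + q) z = cpoly p z + cpoly q z"
proof -
  have "map_poly complex_of_real (p + q) = map_poly of_real p + map_poly of_real q"
    by (rule poly_eqI) (simp add: coeff_map_poly)
  then show ?thesis by (simp add: cpoly_def)
qed

lemma cpoly_smult: "cpoly (smult a p) z = of_real a * cpoly p z"
  by (simp add: cpoly_def map_poly_smult)

lemma cpoly_mult: "cpoly (p * q) z = cpoly p z * cpoly q z"
  by (induction p) (simp_all add: cpoly_pCons cpoly_add cpoly_smult algebra_simps)

lemma cpoly_monom: "cpoly (monom a k) z = of_real a * z ^ k"
  by (simp add: cpoly_def map_poly_monom poly_monom)

lemma cpoly_pcompose: "cpoly (pcompose p q) z = cpoly p (cpoly q z)"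
  by (induction p) (simp_all add: cpoly_pCons cpoly_add cpoly_mult pcompose_pCons)

lemma cpoly_of_real: "cpoly p (of_real x) = of_real (poly p x)"
  by (induction p) (simp_all add: cpoly_pCons)

lemma cpoly_cnj: "cpoly p (cnj z) = cnj (cpoly p z)"
  by (induction p) (simp_all add: cpoly_pCons)

lemma cpoly_even_odd_axis:
  "cpoly (pcompose E (monom 1 2) + monom 1 1 * pcompose D (monom 1 2)) (\<i> * of_real \<omega>)
    = Complex (poly E (- (\<omega>\<^sup>2))) (\<omega> * poly D (- (\<omega>\<^sup>2)))"
proof -
  have "cpoly (monom 1 2) (\<i> * of_real \<omega>) = of_real (- (\<omega>\<^sup>2))"
    by (simp add: cpoly_monom power_mult_distrib)
  then have "cpoly (pcompose p (monom 1 2)) (\<i> * of_real \<omega>) = of_real (poly p (- (\<omega>\<^sup>2)))" for p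
    by (simp only: cpoly_pcompose cpoly_of_real)
  then show ?thesis
    by (simp add: cpoly_add cpoly_mult cpoly_monom complex_eq_iff)
qed

lemma even_odd_split:
  fixes c :: "nat \<Rightarrow> real"
  shows "(\<Sum>i\<le>n. monom (c i) i) =
    pcompose (\<Sum>r | 2 * r \<le> n. monom (c (2 * r)) r) (monom 1 2)
    + monom 1 1 * pcompose (\<Sum>r | 2 * r + 1 \<le> n. monom (c (2 * r + 1)) r) (monom 1 2)"
proof -
  have comp: "pcompose (monom a r) (monom 1 2) = monom a (2 * r)" for a :: real and r
    by (induction r arbitrary: a) (simp_all add: monom_0 monom_Suc pcompose_pCons mult_monom)
  have "{..n} = (\<lambda>r. 2 * r) ` {r. 2 * r \<le> n} \<union> (\<lambda>r. 2 * r + 1) ` {r. 2 * r + 1 \<le> n}"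
    (is "_ = ?A \<union> ?B")
  proof (intro equalityI subsetI)
    fix i assume "i \<in> {..n}"
    then show "i \<in> ?A \<union> ?B" by (cases "even i") (auto elim!: evenE oddE)
  qed auto
  moreover have "?A \<inter> ?B = {}" by (auto, presburger)
  moreover have "finite ?A" "finite ?B"
    using finite_subset[of ?A "{..n}"] finite_subset[of ?B "{..n}"] by auto
  ultimately have "(\<Sum>i\<le>n. monom (c i) i) = (\<Sum>i\<in>?A. monom (c i) i) + (\<Sum>i\<in>?B. monom (c i) i)"
    by (simp add: sum.union_disjoint)
  also have "(\<Sum>i\<in>?A. monom (c i) i) = (\<Sum>r | 2 * r \<le> n. monom (c (2 * r)) (2 * r))"
    by (subst sum.reindex) (auto simp: inj_on_def)
  also have "(\<Sum>i\<in>?B. monom (c i) i) = (\<Sum>r | 2 * r + 1 \<le> n. monom (c (2 * r + 1)) (2 * r + 1))"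
    by (subst sum.reindex) (auto simp: inj_on_def)
  finally show ?thesis
    by (simp add: pcompose_sum comp sum_distrib_left mult_monom)
qed

lemma vertex_poly_eq_sum:
  "vertex_poly n lo hi i k =
    (\<Sum>l\<le>n. monom (alt_bound lo hi (if even l then i else k) (l div 2) l) l)"
  unfolding vertex_poly_def vertex_even_def vertex_odd_def even_odd_split
  by simp

lemma alt_bound_mem:
  "lo l \<le> hi l \<Longrightarrow> alt_bound lo hi i r l \<in> {lo l..hi l}"
  by (simp add: alt_bound_def)

lemma vertex_poly_mem:
  assumes "\<And>l. l \<le> n \<Longrightarrow> lo l \<le> hi l"
  shows "vertex_poly n lo hi i k \<in> interval_polys n lo hi"
proof -
  define c where "c l = alt_bound lo hi (if even l then i else k) (l div 2) l" for l
  have "\<forall>l\<le>n. c l \<in> {lo l..hi l}"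
    unfolding c_def using assms alt_bound_mem by metis
  moreover have "vertex_poly n lo hi i k = (\<Sum>l\<le>n. monom (c l) l)"
    by (simp add: vertex_poly_eq_sum c_def)
  ultimately show ?thesis
    unfolding interval_polys_def by blast
qed

lemma coeff_interval_polys:
  assumes "p \<in> interval_polys n lo hi"
  shows "degree p \<le> n" "coeff p n \<in> {lo n..hi n}"
proof -
  obtain c where p: "p = (\<Sum>i\<le>n. monom (c i) i)" and c: "\<forall>i\<le>n. c i \<in> {lo i..hi i}"
    using assms by (auto simp: interval_polys_def)
  show "degree p \<le> n" unfolding p
    by (rule degree_sum_le) (auto intro: order_trans[OF degree_monom_le])
  show "coeff p n \<in> {lo n..hi n}" using c by (simp add: p coeff_sum)
qed

text \<open>At \<open>s\<^sup>2 = - w\<close> the powers of \<open>s\<^sup>2\<close> alternate in sign, and the alternation of the bounds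
  compensates for this.\<close>

lemma alt_bound_times_neg_power:
  assumes "lo l \<le> c" "c \<le> hi l" "0 \<le> w"
  shows "alt_bound lo hi 1 r l * (- w) ^ r \<le> c * (- w) ^ r"
    and "c * (- w) ^ r \<le> alt_bound lo hi 2 r l * (- w) ^ r"
  using assms by (cases "even r"; simp add: alt_bound_def mult_right_mono)+

text \<open>The value set of an interval polynomial at a frequency \<open>\<omega> \<ge> 0\<close> lies in a rectangle with
  sides parallel to the axes whose corners are the values of the four vertex polynomials.\<close>

lemma interval_polys_axis:
  assumes "p \<in> interval_polys n lo hi" "0 \<le> \<omega>"
  shows "Re (cpoly p (\<i> * of_real \<omega>)) \<in>
      {poly (vertex_even n lo hi 1) (- (\<omega>\<^sup>2))..poly (vertex_even n lo hi 2) (- (\<omega>\<^sup>2))}"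
    and "Im (cpoly p (\<i> * of_real \<omega>)) \<in>
      {\<omega> * poly (vertex_odd n lo hi 1) (- (\<omega>\<^sup>2))..\<omega> * poly (vertex_odd n lo hi 2) (- (\<omega>\<^sup>2))}"
proof -
  obtain c where p: "p = (\<Sum>i\<le>n. monom (c i) i)" and c: "\<forall>i\<le>n. c i \<in> {lo i..hi i}"
    using assms by (auto simp: interval_polys_def)
  show "Re (cpoly p (\<i> * of_real \<omega>)) \<in>
      {poly (vertex_even n lo hi 1) (- (\<omega>\<^sup>2))..poly (vertex_even n lo hi 2) (- (\<omega>\<^sup>2))}"
    unfolding p even_odd_split cpoly_even_odd_axis vertex_even_def
    using c by (auto simp: poly_sum poly_monom simp del: One_nat_def intro!: sum_mono alt_bound_times_neg_power)
  show "Im (cpoly p (\<i> * of_real \<omega>)) \<in>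
      {\<omega> * poly (vertex_odd n lo hi 1) (- (\<omega>\<^sup>2))..\<omega> * poly (vertex_odd n lo hi 2) (- (\<omega>\<^sup>2))}"
    unfolding p even_odd_split cpoly_even_odd_axis vertex_odd_def
    using c assms(2) by (auto simp: poly_sum poly_monom simp del: One_nat_def intro!: mult_left_mono sum_mono alt_bound_times_neg_power)
qed

lemma hurwitz_iff_stable: "hurwitz p \<longleftrightarrow> stable (map_poly of_real p)"
  by (simp add: hurwitz_def stable_def cpoly_def)

text \<open>A real polynomial without zeros on the nonnegative half line keeps the sign of its leading
  coefficient there.\<close>

lemma hurwitz_value_0_times_lead_pos:
  assumes "hurwitz p"
  shows "0 < poly p 0 * lead_coeff p"
proof -
  have nz: "poly p x \<noteq> 0" if "0 \<le> x" for x
  proof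
    assume "poly p x = 0"
    then have "cpoly p (of_real x) = 0" by (simp add: cpoly_of_real)
    then show False using assms that by (force simp: hurwitz_def)
  qed
  have pos: "0 < poly q 0" if q: "0 < lead_coeff q" and nzq: "\<And>x. 0 \<le> x \<Longrightarrow> poly q x \<noteq> 0"
    for q :: "real poly"
  proof (rule ccontr)
    assume "\<not> 0 < poly q 0"
    then have neg: "poly q 0 < 0" using nzq[of 0] by simp
    obtain M where "\<forall>x\<ge>M. lead_coeff q \<le> poly q x" using poly_pinfty_gt_lc[OF q] by blast
    then have "lead_coeff q \<le> poly q (max M 1)" by simp
    then have "0 < poly q (max M 1)" using q by linarith
    moreover have "0 < max M 1" by simp
    ultimately obtain x where "0 < x" "poly q x = 0"
      using poly_IVT_pos[of 0 "max M 1" q] neg by blast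
    then show False using nzq[of x] by simp
  qed
  have "p \<noteq> 0" using nz[of 0] by auto
  then consider "0 < lead_coeff p" | "0 < lead_coeff (- p)" by fastforce
  then show ?thesis
  proof cases
    case 1
    then show ?thesis using pos[of p] nz by simp
  next
    case 2
    then show ?thesis using pos[of "- p"] nz by (simp add: mult_neg_neg)
  qed
qed

section \<open>Zero exclusion for the rectangle of denominators\<close>

definition axis_re :: "nat \<Rightarrow> (nat \<Rightarrow> real) \<Rightarrow> (nat \<Rightarrow> real) \<Rightarrow> nat \<Rightarrow> real \<Rightarrow> real" where
  "axis_re n lo hi i \<omega> = poly (vertex_even n lo hi i) (- (\<omega>\<^sup>2))"

definition axis_im :: "nat \<Rightarrow> (nat \<Rightarrow> real) \<Rightarrow> (nat \<Rightarrow> real) \<Rightarrow> nat \<Rightarrow> real \<Rightarrow> real" where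
  "axis_im n lo hi k \<omega> = \<omega> * poly (vertex_odd n lo hi k) (- (\<omega>\<^sup>2))"

lemma cpoly_vertex_poly_axis:
  "cpoly (vertex_poly n lo hi i k) (\<i> * of_real \<omega>) = Complex (axis_re n lo hi i \<omega>) (axis_im n lo hi k \<omega>)"
  unfolding vertex_poly_def cpoly_even_odd_axis axis_re_def axis_im_def ..

lemma poly_complex_vertex_axis:
  "poly (map_poly of_real (vertex_poly n lo hi i k)) (\<i> * of_real \<omega>)
    = Complex (axis_re n lo hi i \<omega>) (axis_im n lo hi k \<omega>)"
  using cpoly_vertex_poly_axis by (simp add: cpoly_def)

lemma degree_vertex_poly:
  assumes "\<And>l. l \<le> n \<Longrightarrow> lo l \<le> hi l" "0 \<notin> {lo n..hi n}"
  shows "degree (vertex_poly n lo hi i k) = n"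
proof (rule antisym)
  have mem: "vertex_poly n lo hi i k \<in> interval_polys n lo hi"
    by (rule vertex_poly_mem) (rule assms(1))
  show "degree (vertex_poly n lo hi i k) \<le> n" using coeff_interval_polys[OF mem] by simp
  have "coeff (vertex_poly n lo hi i k) n \<noteq> 0"
    using coeff_interval_polys(2)[OF mem] assms(2) by metis
  then show "n \<le> degree (vertex_poly n lo hi i k)" by (rule le_degree)
qed

lemma degree_map_of_real: "degree (map_poly complex_of_real p) = degree p"
  by (rule degree_map_poly) simp

lemma axis_degree_0:
  "axis_re 0 lo hi i \<omega> = axis_re 0 lo hi i 0" "axis_im n lo hi k 0 = 0" "axis_im 0 lo hi k \<omega> = 0"
proof -
  have "{r::nat. r = 0} = {0}" by auto
  then show "axis_re 0 lo hi i \<omega> = axis_re 0 lo hi i 0"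
    by (simp add: axis_re_def vertex_even_def poly_monom)
qed (simp_all add: axis_im_def vertex_odd_def)

text \<open>The leading coefficients of all vertex polynomials have the same sign, since the
  interval for the leading coefficient does not contain \<open>0\<close>. This sign is passed on to the constant
  coefficients.\<close>

lemma axis_re_0_same_sign:
  assumes "\<And>l. l \<le> n \<Longrightarrow> lo l \<le> hi l" "0 \<notin> {lo n..hi n}"
    and "\<And>i k. i \<in> {1, 2} \<Longrightarrow> k \<in> {1, 2} \<Longrightarrow> hurwitz (vertex_poly n lo hi i k)"
  shows "0 < axis_re n lo hi 1 0 * axis_re n lo hi 2 0"
proof -
  have lead: "lead_coeff (vertex_poly n lo hi i k) \<in> {lo n..hi n}" for i k
  proof -
    have "coeff (vertex_poly n lo hi i k) n \<in> {lo n..hi n}"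
      by (rule coeff_interval_polys(2)[OF vertex_poly_mem]) (rule assms(1))
    moreover have "degree (vertex_poly n lo hi i k) = n"
      by (rule degree_vertex_poly) (use assms in auto)
    ultimately show ?thesis by simp
  qed
  have val: "poly (vertex_poly n lo hi i k) 0 = axis_re n lo hi i 0" for i k
    using cpoly_vertex_poly_axis[of n lo hi i k 0] cpoly_of_real[of "vertex_poly n lo hi i k" 0]
    by (simp add: complex_eq_iff)
  have "0 < axis_re n lo hi i 0 * lead_coeff (vertex_poly n lo hi i 1)" if "i \<in> {1, 2}" for i
    using hurwitz_value_0_times_lead_pos[OF assms(3)[OF that, of 1]] val by simp
  from this[of 1] this[of 2] lead[of 1 1] lead[of 2 1] assms(2) show ?thesis
    by (auto simp: zero_less_mult_iff)
qed

lemma zero_between: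
  fixes a b :: real
  assumes "a * b \<le> 0"
  obtains l where "0 \<le> l" "l \<le> 1" "(1 - l) * a + l * b = 0"
proof (cases "a = b")
  case True
  then have "a = 0" using assms by (metis mult_le_0_iff order_antisym)
  then show ?thesis using True that[of 0] by simp
next
  case False
  show ?thesis
  proof (rule that[of "a / (a - b)"])
    show "0 \<le> a / (a - b)" "a / (a - b) \<le> 1"
      using False assms by (auto simp: zero_le_divide_iff divide_le_eq_1 mult_le_0_iff)
    show "(1 - a / (a - b)) * a + a / (a - b) * b = 0" using False by (simp add: field_simps)
  qed
qed

text \<open>Kharitonov's theorem in the form of zero exclusion. The products describe when the
  rectangle meets \<open>0\<close>, for frequencies of either sign. The set of such frequencies is closed.
  Because \<open>0\<close> is never on an edge, it is also given by strict inequalities, hence open. It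
  does not contain the frequency \<open>0\<close>, so by connectedness it is empty.\<close>

lemma rectangle_excludes_zero:
  assumes le: "\<And>l. l \<le> n \<Longrightarrow> lo l \<le> hi l" and lead: "0 \<notin> {lo n..hi n}"
    and hur: "\<And>i k. i \<in> {1, 2} \<Longrightarrow> k \<in> {1, 2} \<Longrightarrow> hurwitz (vertex_poly n lo hi i k)"
  shows "\<not> (axis_re n lo hi 1 \<omega> * axis_re n lo hi 2 \<omega> \<le> 0 \<and>
    axis_im n lo hi 1 \<omega> * axis_im n lo hi 2 \<omega> \<le> 0)"
proof (cases "n = 0")
  case True
  then show ?thesis using axis_re_0_same_sign[OF assms] axis_degree_0(1)[of lo hi _ \<omega>] by simp
next
  case False
  let ?x = "axis_re n lo hi" and ?y = "axis_im n lo hi"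
  let ?V = "\<lambda>i k. map_poly complex_of_real (vertex_poly n lo hi i k)"
  have deg: "0 < degree (?V i k)" for i k
    using degree_vertex_poly[of n lo hi i k] le lead False by (simp add: degree_map_of_real)
  have st: "stable (?V i k)" if "i \<in> {1, 2}" "k \<in> {1, 2}" for i k
    using hur[OF that] by (simp add: hurwitz_iff_stable)
  have vert: "\<not> (?x i t = 0 \<and> ?y 1 t * ?y 2 t \<le> 0)" if i: "i \<in> {1, 2}" for i t
  proof safe
    assume x: "?x i t = 0" and "?y 1 t * ?y 2 t \<le> 0"
    then obtain l where l: "0 \<le> l" "l \<le> 1" "(1 - l) * ?y 1 t + l * ?y 2 t = 0"
      using zero_between by blast
    have "(1 - of_real l) * poly (?V i 1) (\<i> * of_real t) + of_real l * poly (?V i 2) (\<i> * of_real t) \<noteq> 0"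
      by (rule edge_nonvanishing[where d = \<i>])
        (use st[OF i] deg l in \<open>auto simp: poly_complex_vertex_axis Im_divide\<close>)
    then show False using x l(3) by (simp add: poly_complex_vertex_axis complex_eq_iff)
  qed
  have horiz: "\<not> (?y k t = 0 \<and> ?x 1 t * ?x 2 t \<le> 0)" if k: "k \<in> {1, 2}" for k t
  proof safe
    assume y: "?y k t = 0" and "?x 1 t * ?x 2 t \<le> 0"
    then obtain l where l: "0 \<le> l" "l \<le> 1" "(1 - l) * ?x 1 t + l * ?x 2 t = 0"
      using zero_between by blast
    have "(1 - of_real l) * poly (?V 1 k) (\<i> * of_real t) + of_real l * poly (?V 2 k) (\<i> * of_real t) \<noteq> 0"
      by (rule edge_nonvanishing[where d = 1])
        (use st[OF _ k] deg l in \<open>auto simp: poly_complex_vertex_axis\<close>)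
    then show False using y l(3) by (simp add: poly_complex_vertex_axis complex_eq_iff)
  qed
  define A where "A = {t. ?x 1 t * ?x 2 t \<le> 0 \<and> ?y 1 t * ?y 2 t \<le> 0}"
  have A: "A = {t. ?x 1 t * ?x 2 t < 0 \<and> ?y 1 t * ?y 2 t < 0}"
  proof -
    have "?x 1 t * ?x 2 t \<noteq> 0 \<and> ?y 1 t * ?y 2 t \<noteq> 0" if "t \<in> A" for t
      using that vert[of 1 t] vert[of 2 t] horiz[of 1 t] horiz[of 2 t] by (auto simp: A_def)
    then show ?thesis unfolding A_def by (auto simp: less_le)
  qed
  have cont: "continuous_on UNIV (?x i)" "continuous_on UNIV (?y i)" for i
    unfolding axis_re_def axis_im_def by (intro continuous_intros)+
  have "closed A"
    unfolding A_def by (intro closed_Collect_conj closed_Collect_le continuous_intros cont)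
  moreover have "open A"
    unfolding A by (intro open_Collect_conj open_Collect_less continuous_intros cont)
  moreover have "0 \<notin> A"
    using axis_re_0_same_sign[OF assms] by (simp add: A_def)
  ultimately have "A = {}" using clopen[of A] by auto
  then show ?thesis by (auto simp: A_def)
qed

section \<open>Quotients of points in two rectangles\<close>

text \<open>For \<open>f = x + \<i> y\<close> in the first quadrant, \<open>Re (g / f)\<close> is smallest at the lower left
  corner \<open>u1 + \<i> v1\<close> of the rectangle for \<open>g\<close>. If it is negative there, then moving \<open>f\<close> towards
  the origin lowers it further, as the ratio is homogeneous of degree \<open>-1\<close> in \<open>f\<close>. Since the
  rectangle for \<open>f\<close> does not contain the origin, the ray meets the left or the lower edge.\<close>

lemma quadrant_ratio_bound:
  fixes x y u v x1 y1 u1 v1 \<gamma> :: real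
  assumes xy: "0 \<le> x" "0 \<le> y" and lo: "x1 \<le> x" "y1 \<le> y" "u1 \<le> u" "v1 \<le> v"
    and corner: "0 < x1 \<or> 0 < y1" and neg: "\<gamma> \<le> 0"
    and vert: "\<And>t. t \<in> {y1..y} \<Longrightarrow> \<gamma> \<le> (u1 * x1 + v1 * t) / (x1\<^sup>2 + t\<^sup>2)"
    and horiz: "\<And>t. t \<in> {x1..x} \<Longrightarrow> \<gamma> \<le> (u1 * t + v1 * y1) / (t\<^sup>2 + y1\<^sup>2)"
  shows "\<gamma> \<le> (u * x + v * y) / (x\<^sup>2 + y\<^sup>2)"
proof -
  have pos: "0 < x\<^sup>2 + y\<^sup>2" using corner lo by (auto simp: sum_power2_gt_zero_iff)
  have "(u1 * x + v1 * y) / (x\<^sup>2 + y\<^sup>2) \<le> (u * x + v * y) / (x\<^sup>2 + y\<^sup>2)"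
    using pos xy lo by (intro divide_right_mono add_mono mult_right_mono) auto
  moreover have "\<gamma> \<le> (u1 * x + v1 * y) / (x\<^sup>2 + y\<^sup>2)"
  proof (cases "0 \<le> u1 * x + v1 * y")
    case True
    then have "0 \<le> (u1 * x + v1 * y) / (x\<^sup>2 + y\<^sup>2)" using pos by simp
    then show ?thesis using neg by simp
  next
    case False
    \<comment> \<open>The smallest factor that keeps \<open>s x \<ge> x1\<close> and \<open>s y \<ge> y1\<close>. If \<open>x = 0\<close> or \<open>y = 0\<close> the
      corresponding quotient is \<open>0\<close> and the other one is positive.\<close>
    define s where "s = max (x1 / x) (y1 / y)"
    have s: "0 < s" "s \<le> 1"
      using xy lo corner by (auto simp: s_def less_max_iff_disj divide_le_eq_1)
    have ge: "x1 \<le> s * x" "y1 \<le> s * y"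
    proof -
      have "x1 / x \<le> s" "y1 / y \<le> s" by (auto simp: s_def)
      then show "x1 \<le> s * x" "y1 \<le> s * y" using xy lo
        by (cases "x = 0"; cases "y = 0"; auto simp: pos_divide_le_eq)+
    qed
    have le: "s * x \<le> x" "s * y \<le> y" using s xy by (auto intro: mult_left_le_one_le)
    have "s * x = x1 \<or> s * y = y1"
      using s by (auto simp: s_def max_def split: if_splits)
    then have "\<gamma> \<le> (u1 * (s * x) + v1 * (s * y)) / ((s * x)\<^sup>2 + (s * y)\<^sup>2)"
      using vert[of "s * y"] horiz[of "s * x"] ge le by auto
    also have "u1 * (s * x) + v1 * (s * y) = s * (u1 * x + v1 * y)" by (simp add: algebra_simps)
    also have "(s * x)\<^sup>2 + (s * y)\<^sup>2 = s * (s * (x\<^sup>2 + y\<^sup>2))"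
      by (simp add: power_mult_distrib power2_eq_square algebra_simps)
    also have "s * (u1 * x + v1 * y) / (s * (s * (x\<^sup>2 + y\<^sup>2))) = (u1 * x + v1 * y) / (s * (x\<^sup>2 + y\<^sup>2))"
      using s by simp
    also have "\<dots> \<le> (u1 * x + v1 * y) / (x\<^sup>2 + y\<^sup>2)"
      using s pos False by (intro divide_left_mono_neg) (auto simp: mult_le_cancel_right1)
    finally show ?thesis .
  qed
  ultimately show ?thesis by simp
qed

text \<open>This is where the index set comes from. The quadrant of \<open>f\<close> determines the best
  corner for \<open>g\<close> and the two edges for \<open>f\<close> that face the origin. Such an edge has two end points,
  and the two edges share one of them, so that each of the four quadrants needs three pairs of
  vertices. These are the twelve members of \<open>I3\<close>. The three other quadrants are reflected to the
  first one.\<close>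

lemma rectangle_ratio_bound:
  fixes x y u v :: "nat \<Rightarrow> real"
  assumes neg: "\<gamma> \<le> 0" and zero: "\<not> (x 1 * x 2 \<le> 0 \<and> y 1 * y 2 \<le> 0)"
    and vert: "\<And>i1 j1 i2 t. (i1, j1, i2, 1) \<in> I3 \<Longrightarrow> (i1, j1, i2, 2) \<in> I3 \<Longrightarrow> t \<in> {y 1..y 2} \<Longrightarrow>
      \<gamma> \<le> (u i1 * x i2 + v j1 * t) / ((x i2)\<^sup>2 + t\<^sup>2)"
    and horiz: "\<And>i1 j1 j2 t. (i1, j1, 1, j2) \<in> I3 \<Longrightarrow> (i1, j1, 2, j2) \<in> I3 \<Longrightarrow> t \<in> {x 1..x 2} \<Longrightarrow>
      \<gamma> \<le> (u i1 * t + v j1 * y j2) / (t\<^sup>2 + (y j2)\<^sup>2)"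
    and box: "X \<in> {x 1..x 2}" "Y \<in> {y 1..y 2}" "U \<in> {u 1..u 2}" "V \<in> {v 1..v 2}"
  shows "\<gamma> \<le> (U * X + V * Y) / (X\<^sup>2 + Y\<^sup>2)"
proof -
  have zero': "(0 < x 1 \<or> x 2 < 0) \<or> (0 < y 1 \<or> y 2 < 0)"
    using zero box by (auto simp: mult_le_0_iff not_le)
  note I = I3_def
  consider "0 \<le> X" "0 \<le> Y" | "X \<le> 0" "0 \<le> Y" | "X \<le> 0" "Y \<le> 0" | "0 \<le> X" "Y \<le> 0"
    by linarith
  then show ?thesis
  proof cases
    case 1
    show ?thesis
      by (rule quadrant_ratio_bound[of X Y "x 1" "y 1" "u 1" U "v 1" V \<gamma>])
        (use 1 box neg zero' vert[of 1 1 1] horiz[of 1 1 1] in \<open>auto simp: I\<close>)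
  next
    case 2
    have "\<gamma> \<le> ((- U) * (- X) + V * Y) / ((- X)\<^sup>2 + Y\<^sup>2)"
      apply (rule quadrant_ratio_bound[of "- X" Y "- x 2" "y 1" "- u 2" "- U" "v 1" V \<gamma>])
      using 2 box neg zero' apply auto[8]
      subgoal for t using vert[of 2 1 2 t] 2 box by (auto simp: I)
      subgoal for t using horiz[of 2 1 1 "- t"] 2 box by (auto simp: I)
      done
    then show ?thesis by simp
  next
    case 3
    have "\<gamma> \<le> ((- U) * (- X) + (- V) * (- Y)) / ((- X)\<^sup>2 + (- Y)\<^sup>2)"
      apply (rule quadrant_ratio_bound[of "- X" "- Y" "- x 2" "- y 2" "- u 2" "- U" "- v 2" "- V" \<gamma>])
      using 3 box neg zero' apply auto[8]
      subgoal for t using vert[of 2 2 2 "- t"] 3 box by (auto simp: I)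
      subgoal for t using horiz[of 2 2 2 "- t"] 3 box by (auto simp: I)
      done
    then show ?thesis by simp
  next
    case 4
    have "\<gamma> \<le> (U * X + (- V) * (- Y)) / (X\<^sup>2 + (- Y)\<^sup>2)"
      apply (rule quadrant_ratio_bound[of X "- Y" "x 1" "- y 2" "u 1" U "- v 2" "- V" \<gamma>])
      using 4 box neg zero' apply auto[8]
      subgoal for t using vert[of 1 2 1 "- t"] 4 box by (auto simp: I)
      subgoal for t using horiz[of 1 2 2 t] 4 box by (auto simp: I)
      done
    then show ?thesis by simp
  qed
qed

section \<open>Interval rational functions\<close>

lemma Re_Complex_divide: "Re (Complex u v / Complex x y) = (u * x + v * y) / (x\<^sup>2 + y\<^sup>2)"
  by (simp add: Re_divide)

lemma I3_indices:
  assumes "(i1, j1, i2, j2) \<in> I3"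
  shows "i1 \<in> {1, 2}" "j1 \<in> {1, 2}" "i2 \<in> {1, 2}" "j2 \<in> {1, 2}"
  using assms by (auto simp: I3_def)

lemma convex_param:
  fixes a b t :: real
  assumes "t \<in> {a..b}"
  obtains l where "0 \<le> l" "l \<le> 1" "t = (1 - l) * a + l * b"
proof -
  have "t \<in> closed_segment a b" using assms by (auto simp: closed_segment_eq_real_ivl)
  then show ?thesis using that by (auto simp: closed_segment_def)
qed

lemma real_ratio_between:
  fixes a b u t \<gamma> :: real
  assumes "0 < a * b" "\<gamma> \<le> u / a" "\<gamma> \<le> u / b" "t \<in> {a..b}"
  shows "\<gamma> \<le> u / t"
proof -
  have "0 < a \<or> b < 0" using assms by (auto simp: zero_less_mult_iff)
  then show ?thesis
  proof
    assume a: "0 < a"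
    then have "0 < t" "0 < b" using assms by auto
    then have "\<gamma> * a \<le> u" "\<gamma> * b \<le> u" "0 < t" using a assms by (simp_all add: pos_le_divide_eq)
    moreover have "\<gamma> * t \<le> max (\<gamma> * a) (\<gamma> * b)"
      using assms(4) by (cases "0 \<le> \<gamma>") (auto simp: le_max_iff_disj mult_left_mono mult_left_mono_neg)
    ultimately show ?thesis by (simp add: pos_le_divide_eq)
  next
    assume b: "b < 0"
    then have "t < 0" "a < 0" using assms by auto
    then have "u \<le> \<gamma> * a" "u \<le> \<gamma> * b" "t < 0" using b assms by (simp_all add: neg_le_divide_eq)
    moreover have "min (\<gamma> * a) (\<gamma> * b) \<le> \<gamma> * t"
      using assms(4) by (cases "0 \<le> \<gamma>") (auto simp: min_le_iff_disj mult_left_mono mult_left_mono_neg)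
    ultimately show ?thesis by (simp add: neg_le_divide_eq)
  qed
qed

text \<open>Every pair of vertices \<open>g\<close>, \<open>f\<close> in \<open>I3\<close> satisfies the bound at all frequencies, so
  the bound extends along the edges of the rectangle for \<open>f\<close> that connect two such pairs, and from
  these edges to the whole rectangles. The case \<open>n = 0\<close> is separate, since the phase of a
  constant does not increase.\<close>

lemma interval_ratio_ge:
  fixes \<gamma> :: real
  assumes mn: "m \<le> n" and lea: "\<And>i. i \<le> m \<Longrightarrow> al i \<le> au i" and leb: "\<And>i. i \<le> n \<Longrightarrow> bl i \<le> bu i"
    and lead: "0 \<notin> {bl n..bu n}"
    and hur: "\<And>i k. i \<in> {1, 2} \<Longrightarrow> k \<in> {1, 2} \<Longrightarrow> hurwitz (vertex_poly n bl bu i k)"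
    and vertex: "\<And>i1 j1 i2 j2 \<omega>. (i1, j1, i2, j2) \<in> I3 \<Longrightarrow>
      \<gamma> \<le> Re (cpoly (vertex_poly m al au i1 j1) (\<i> * of_real \<omega>) /
        cpoly (vertex_poly n bl bu i2 j2) (\<i> * of_real \<omega>))"
    and neg: "\<gamma> \<le> 0"
    and g: "g \<in> interval_polys m al au" and f: "f \<in> interval_polys n bl bu"
  shows "\<gamma> \<le> Re (cpoly g (\<i> * of_real \<omega>) / cpoly f (\<i> * of_real \<omega>))"
proof -
  let ?G = "\<lambda>i k. map_poly complex_of_real (vertex_poly m al au i k)"
  let ?F = "\<lambda>i k. map_poly complex_of_real (vertex_poly n bl bu i k)"
  let ?u = "axis_re m al au" and ?v = "axis_im m al au"
  let ?x = "axis_re n bl bu" and ?y = "axis_im n bl bu"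
  have degF: "degree (?F i k) = n" for i k
    using degree_vertex_poly[of n bl bu i k] leb lead by (simp add: degree_map_of_real)
  have degG: "degree (?G i k) \<le> n" for i k
    using coeff_interval_polys(1)[OF vertex_poly_mem[of m al au i k]] lea mn
    by (simp add: degree_map_of_real)
  have st: "stable (?F i k)" if "i \<in> {1, 2}" "k \<in> {1, 2}" for i k
    using hur[OF that] by (simp add: hurwitz_iff_stable)
  have vertex': "\<gamma> \<le> Re (poly (?G i1 j1) (\<i> * of_real t) / poly (?F i2 j2) (\<i> * of_real t))"
    if "(i1, j1, i2, j2) \<in> I3" for i1 j1 i2 j2 t
    using vertex[OF that, of t] by (simp add: cpoly_def)
  have vertex_xy: "\<gamma> \<le> (?u i1 t * ?x i2 t + ?v j1 t * ?y j2 t) / ((?x i2 t)\<^sup>2 + (?y j2 t)\<^sup>2)"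
    if "(i1, j1, i2, j2) \<in> I3" for i1 j1 i2 j2 t
    using vertex[OF that, of t] by (simp only: cpoly_vertex_poly_axis Re_Complex_divide)
  note zero = rectangle_excludes_zero[of n bl bu, OF leb lead hur]
  have vert: "\<gamma> \<le> (?u i1 w * ?x i2 w + ?v j1 w * t) / ((?x i2 w)\<^sup>2 + t\<^sup>2)"
    if I: "(i1, j1, i2, 1) \<in> I3" "(i1, j1, i2, 2) \<in> I3" and t: "t \<in> {?y 1 w..?y 2 w}" for i1 j1 i2 t w
  proof (cases "n = 0")
    case True
    then have "t = ?y 1 w" using t axis_degree_0 by simp
    then show ?thesis using vertex_xy[OF I(1)] by simp
  next
    case False
    obtain l where l: "0 \<le> l" "l \<le> 1" "t = (1 - l) * ?y 1 w + l * ?y 2 w"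
      using convex_param[OF t] by blast
    note i2 = I3_indices(3)[OF I(1)]
    have "\<gamma> \<le> Re (poly (?G i1 j1) (\<i> * of_real w) / ((1 - of_real l) * poly (?F i2 1) (\<i> * of_real w)
        + of_real l * poly (?F i2 2) (\<i> * of_real w)))"
      by (rule Re_ratio_ge_edge[where d = \<i>])
        (use st[OF i2] degF degG False vertex'[OF I(1)] vertex'[OF I(2)] neg l
          in \<open>auto simp: poly_complex_vertex_axis Im_divide\<close>)
    also have "(1 - of_real l) * poly (?F i2 1) (\<i> * of_real w) + of_real l * poly (?F i2 2) (\<i> * of_real w)
        = Complex (?x i2 w) t"
      by (simp add: poly_complex_vertex_axis complex_eq_iff l algebra_simps)
    finally show ?thesis by (simp only: poly_complex_vertex_axis Re_Complex_divide)
  qed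
  have horiz: "\<gamma> \<le> (?u i1 w * t + ?v j1 w * ?y j2 w) / (t\<^sup>2 + (?y j2 w)\<^sup>2)"
    if I: "(i1, j1, 1, j2) \<in> I3" "(i1, j1, 2, j2) \<in> I3" and t: "t \<in> {?x 1 w..?x 2 w}" for i1 j1 j2 t w
  proof (cases "n = 0")
    case True
    then have y0: "?y k w = 0" "?v k w = 0" for k using axis_degree_0 mn by auto
    have "\<gamma> \<le> ?u i1 w / t"
    proof (rule real_ratio_between)
      show "0 < ?x 1 w * ?x 2 w" using zero[of w] y0 by simp
    qed (use vertex_xy[OF I(1), of w] vertex_xy[OF I(2), of w] y0 t in \<open>auto simp: power2_eq_square split: if_splits\<close>)
    then show ?thesis using y0 neg by (simp add: power2_eq_square)
  next
    case False
    obtain l where l: "0 \<le> l" "l \<le> 1" "t = (1 - l) * ?x 1 w + l * ?x 2 w"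
      using convex_param[OF t] by blast
    note j2 = I3_indices(4)[OF I(1)]
    have "\<gamma> \<le> Re (poly (?G i1 j1) (\<i> * of_real w) / ((1 - of_real l) * poly (?F 1 j2) (\<i> * of_real w)
        + of_real l * poly (?F 2 j2) (\<i> * of_real w)))"
      by (rule Re_ratio_ge_edge[where d = 1])
        (use st[OF _ j2] degF degG False vertex'[OF I(1)] vertex'[OF I(2)] neg l
          in \<open>auto simp: poly_complex_vertex_axis\<close>)
    also have "(1 - of_real l) * poly (?F 1 j2) (\<i> * of_real w) + of_real l * poly (?F 2 j2) (\<i> * of_real w)
        = Complex t (?y j2 w)"
      by (simp add: poly_complex_vertex_axis complex_eq_iff l algebra_simps)
    finally show ?thesis by (simp only: poly_complex_vertex_axis Re_Complex_divide)
  qed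
  \<comment> \<open>For negative frequencies the rectangle is reflected, so they are treated by conjugation.\<close>
  have nonneg: "\<gamma> \<le> Re (cpoly g (\<i> * of_real w) / cpoly f (\<i> * of_real w))" if w: "0 \<le> w" for w
    unfolding Re_divide
    by (rule rectangle_ratio_bound[where x = "\<lambda>i. ?x i w" and y = "\<lambda>i. ?y i w"
          and u = "\<lambda>i. ?u i w" and v = "\<lambda>i. ?v i w"])
      (use neg zero vert horiz interval_polys_axis[OF g w] interval_polys_axis[OF f w]
        in \<open>auto simp: axis_re_def axis_im_def\<close>)
  show ?thesis
  proof (cases "0 \<le> \<omega>")
    case False
    have "\<i> * of_real \<omega> = cnj (\<i> * of_real (- \<omega>))" by simp
    then have "cpoly g (\<i> * of_real \<omega>) / cpoly f (\<i> * of_real \<omega>)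
        = cnj (cpoly g (\<i> * of_real (- \<omega>)) / cpoly f (\<i> * of_real (- \<omega>)))"
      by (simp only: cpoly_cnj complex_cnj_divide)
    then have "Re (cpoly g (\<i> * of_real \<omega>) / cpoly f (\<i> * of_real \<omega>))
        = Re (cpoly g (\<i> * of_real (- \<omega>)) / cpoly f (\<i> * of_real (- \<omega>)))"
      by (simp only: cnj.sel)
    then show ?thesis using nonneg[of "- \<omega>"] False by linarith
  qed (rule nonneg)
qed

theorem theorem3:
  fixes m n :: nat
    and al au bl bu :: "nat \<Rightarrow> real"
    and \<gamma>0 :: ereal
  assumes "m \<le> n"
    and "\<And>i. i \<le> m \<Longrightarrow> al i \<le> au i"
    and "\<And>i. i \<le> n \<Longrightarrow> bl i \<le> bu i"
    and "0 \<notin> {bl n..bu n}"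
    and "\<And>i k. i \<in> {1, 2} \<Longrightarrow> k \<in> {1, 2} \<Longrightarrow> hurwitz (vertex_poly n bl bu i k)"
    and "is_minimum
           {inf_re_ratio (vertex_poly m al au i1 j1) (vertex_poly n bl bu i2 j2)
             | i1 j1 i2 j2. (i1, j1, i2, j2) \<in> I3} \<gamma>0"
    and "\<gamma>0 < 0"
  shows "is_minimum
           {inf_re_ratio g f | g f. g \<in> interval_polys m al au \<and> f \<in> interval_polys n bl bu} \<gamma>0"
proof -
  have "vertex_poly m al au i k \<in> interval_polys m al au"
    "vertex_poly n bl bu i k \<in> interval_polys n bl bu" for i k
    using assms(2,3) by (auto intro: vertex_poly_mem)
  then have attained: "\<gamma>0 \<in> {inf_re_ratio g f | g f. g \<in> interval_polys m al au \<and> f \<in> interval_polys n bl bu}"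
    using assms(6) unfolding is_minimum_def by blast
  moreover have "\<gamma>0 \<le> inf_re_ratio g f"
    if gf: "g \<in> interval_polys m al au" "f \<in> interval_polys n bl bu" for g f
  proof (cases \<gamma>0)
    \<comment> \<open>An infinite \<open>\<gamma>0\<close> is \<open>-\<infinity>\<close>, for which there is nothing to show.\<close>
    case (real \<gamma>)
    have "\<gamma> \<le> Re (cpoly (vertex_poly m al au i1 j1) (\<i> * of_real \<omega>) /
        cpoly (vertex_poly n bl bu i2 j2) (\<i> * of_real \<omega>))"
      if "(i1, j1, i2, j2) \<in> I3" for i1 j1 i2 j2 \<omega>
    proof -
      have "\<gamma>0 \<le> inf_re_ratio (vertex_poly m al au i1 j1) (vertex_poly n bl bu i2 j2)"
        using assms(6) that unfolding is_minimum_def by blast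
      also have "\<dots> \<le> ereal (Re (cpoly (vertex_poly m al au i1 j1) (\<i> * of_real \<omega>) /
          cpoly (vertex_poly n bl bu i2 j2) (\<i> * of_real \<omega>)))"
        unfolding inf_re_ratio_def by (rule INF_lower) simp
      finally show ?thesis using real by simp
    qed
    moreover have "\<gamma> \<le> 0" using real assms(7) by simp
    ultimately show ?thesis
      unfolding inf_re_ratio_def real
      by (intro INF_greatest) (use interval_ratio_ge[OF assms(1-5) _ _ gf] in auto)
  qed (use assms(7) in auto)
  ultimately show ?thesis unfolding is_minimum_def by blast
qed

end
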